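(* Let $N\ge1$, $p\ge2$, $w,g\in L^1_{loc}(\mathbb{R}^N)$ positive a.e. with $g^{-1}\in L^\infty(\mathbb{R}^N)$. Let $0<\delta<\gamma$ with $\gamma\ge1$ and $(\delta,p)$ in the class $P_b$. Assume there exist constants $\lambda>0$ and $C>0$ such that $\lambda<pS_p^b$ and $\int_{B_{2R}(0)}w^{S_p^b}dx\le CR^{\lambda}$ for all $R\ge1$. Then there is no $u\in C^1(\mathbb{R}^N)$ with $u\ge1$ in $\mathbb{R}^N$ which is a stable weak solution of $\operatorname{div}(w|\nabla u|^{p-2}\nabla u)=g(x)(u^{-\delta}+u^{-\gamma})$ in $\mathbb{R}^N$.
   Context: Weak solution and stability are with respect to $f(t)=-t^{-\delta}-t^{-\gamma}$ and the equation $-\operatorname{div}(w|\nabla u|^{p-2}\nabla u)=gf(u)$: $u\in C^1$ is a weak solution if $\int w|\nabla u|^{p-2}\nabla u\cdot\nabla\varphi=\int gf(u)\varphi$ for all $\varphi\in C^1_c(\mathbb{R}^N)$; it is stable if for all $\varphi\in C^1_c(\mathbb{R}^N)$, $\int w|\nabla u|^{p-2}|\nabla\varphi|^2+(p-2)\int w|\nabla u|^{p-4}(\nabla u\cdot\nabla\varphi)^2-\int gf'(u)\varphi^2\ge0$ (middle integrand $=0$ where $\nabla u=0$). Class $P_b$: $(\delta,p)\in P_b$ if either $p=2$ and $\delta>0$, or $p>2$ and $\delta>\frac{(p-1)^2}{4}$. $s_p=\delta+\sqrt{\delta^2+\delta}$ if $p=2$, $s_p=\frac{2\delta}{p-1}-\frac{p-1}{2}$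 if $p>2$; $S_p^b=1+\frac{2s_p}{p-1+\gamma}$. $B_r(0)$ is the open ball of radius $r$ centered at the origin. *)

theory Defs
  imports "HOL-Analysis.Analysis"
begin

text \<open>Power t^a of a nonnegative real, with the convention t^0 = 1 (also for t = 0).\<close>
definition npow :: "real \<Rightarrow> real \<Rightarrow> real" where
  "npow t a = (if a = 0 then 1 else t powr a)"

definition fnl :: "real \<Rightarrow> real \<Rightarrow> real \<Rightarrow> real" where
  "fnl \<delta> \<gamma> t = - (t powr (-\<delta>)) - t powr (-\<gamma>)"

definition fnl' :: "real \<Rightarrow> real \<Rightarrow> real \<Rightarrow> real" where
  "fnl' \<delta> \<gamma> t = \<delta> * t powr (-\<delta> - 1) + \<gamma> * t powr (-\<gamma> - 1)"

definition C1_grad :: "(real^'n \<Rightarrow> real) \<Rightarrow> (real^'n \<Rightarrow> real^'n) \<Rightarrow> bool" where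
  "C1_grad u Du \<longleftrightarrow> (\<forall>x. (u has_derivative (\<lambda>h. Du x \<bullet> h)) (at x)) \<and> continuous_on UNIV Du"

definition C1c_grad :: "(real^'n \<Rightarrow> real) \<Rightarrow> (real^'n \<Rightarrow> real^'n) \<Rightarrow> bool" where
  "C1c_grad \<phi> D\<phi> \<longleftrightarrow> C1_grad \<phi> D\<phi> \<and> compact (closure {x. \<phi> x \<noteq> 0})"

definition L1_loc :: "(real^'n \<Rightarrow> real) \<Rightarrow> bool" where
  "L1_loc w \<longleftrightarrow> w \<in> borel_measurable lebesgue \<and>
     (\<forall>K. compact K \<longrightarrow> set_integrable lebesgue K w)"

definition weak_solution ::
  "real \<Rightarrow> real \<Rightarrow> real \<Rightarrow> (real^'n \<Rightarrow> real) \<Rightarrow> (real^'n \<Rightarrow> real)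
    \<Rightarrow> (real^'n \<Rightarrow> real) \<Rightarrow> (real^'n \<Rightarrow> real^'n) \<Rightarrow> bool" where
  "weak_solution p \<delta> \<gamma> w g u Du \<longleftrightarrow>
     (\<forall>\<phi> D\<phi>. C1c_grad \<phi> D\<phi> \<longrightarrow>
        (\<integral>x. w x * npow (norm (Du x)) (p - 2) * (Du x \<bullet> D\<phi> x) \<partial>lebesgue)
        = (\<integral>x. g x * fnl \<delta> \<gamma> (u x) * \<phi> x \<partial>lebesgue))"

definition stable ::
  "real \<Rightarrow> real \<Rightarrow> real \<Rightarrow> (real^'n \<Rightarrow> real) \<Rightarrow> (real^'n \<Rightarrow> real)
    \<Rightarrow> (real^'n \<Rightarrow> real) \<Rightarrow> (real^'n \<Rightarrow> real^'n) \<Rightarrow> bool" where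
  "stable p \<delta> \<gamma> w g u Du \<longleftrightarrow>
     (\<forall>\<phi> D\<phi>. C1c_grad \<phi> D\<phi> \<longrightarrow>
        (\<integral>x. w x * npow (norm (Du x)) (p - 2) * (norm (D\<phi> x))\<^sup>2 \<partial>lebesgue)
        + (p - 2) * (\<integral>x. (if Du x = 0 then 0
              else w x * norm (Du x) powr (p - 4) * (Du x \<bullet> D\<phi> x)\<^sup>2) \<partial>lebesgue)
        - (\<integral>x. g x * fnl' \<delta> \<gamma> (u x) * (\<phi> x)\<^sup>2 \<partial>lebesgue) \<ge> 0)"

definition class_Pb :: "real \<Rightarrow> real \<Rightarrow> bool" where
  "class_Pb \<delta> p \<longleftrightarrow> (p = 2 \<and> \<delta> > 0) \<or> (p > 2 \<and> \<delta> > (p - 1)\<^sup>2 / 4)"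

definition s_p :: "real \<Rightarrow> real \<Rightarrow> real" where
  "s_p \<delta> p = (if p = 2 then \<delta> + sqrt (\<delta>\<^sup>2 + \<delta>) else 2 * \<delta> / (p - 1) - (p - 1) / 2)"

definition S_pb :: "real \<Rightarrow> real \<Rightarrow> real \<Rightarrow> real" where
  "S_pb \<delta> \<gamma> p = 1 + 2 * s_p \<delta> p / (p - 1 + \<gamma>)"

end

theory Submission
  imports Defs
begin

text \<open>
  Test stability with u powr (-\<alpha>) * \<eta> and the weak equation with
  u powr (-2\<alpha>-1) * \<eta>^2, and add the second, multiplied by some \<mu>, to the first. If
  (p-1)\<alpha>^2 < \<delta>(2\<alpha>+1), one can choose \<mu> so that both the terms in |Du|^p and the
  zero-order terms have a negative sign; since 1/g is bounded, Young's inequality then absorbs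
  the rest pointwise, leaving
  \<integral> u powr (-\<delta>-2\<alpha>-1) * \<eta>^2 \<le> const * R powr (-pS) * \<integral> w powr S over the ball of radius 2R.
  The growth hypothesis sends the right-hand side to 0 as R \<rightarrow> \<infinity>, while the left-hand side
  stays bounded below by its part on the unit ball. The strict inequality \<delta> < \<gamma> makes the
  exponent S exactly reachable with an admissible \<alpha>, even for p = 2, where the critical \<alpha> itself
  is excluded.
\<close>

section \<open>Scalar inequalities for absorbing error terms\<close>

lemma npow_nonneg [simp]: "npow t a \<ge> 0"
  by (simp add: npow_def)

lemma npow_mult: "0 \<le> s \<Longrightarrow> 0 < t \<Longrightarrow> npow (s * t) a = npow s a * t powr a"
  by (simp add: npow_def powr_mult)

lemma npow_mono: "0 \<le> s \<Longrightarrow> s \<le> t \<Longrightarrow> 0 \<le> a \<Longrightarrow> npow s a \<le> npow t a"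
  by (auto simp: npow_def intro: powr_mono2)

lemma continuous_on_npow_norm:
  assumes "a \<ge> 0" "continuous_on A f"
  shows "continuous_on A (\<lambda>x. npow (norm (f x)) a)"
proof (cases "a = 0")
  case False
  with assms have "continuous_on A (\<lambda>x. norm (f x) powr a)"
    by (intro continuous_on_powr' continuous_intros) auto
  with False show ?thesis by (simp add: npow_def)
qed (simp add: npow_def)

text \<open>Weighted Young inequality with conjugate exponents S and S/(S - 1), proved without
  convexity: either \<open>W \<le> \<epsilon> * Z powr (1 / (S - 1))\<close> and the first term
  alone dominates, or this fails, and raising the reverse inequality to the power S - 1 bounds Z so
  that the second term does.\<close>

lemma young_powr:
  fixes S \<epsilon> W Z :: real
  assumes "S > 1" "\<epsilon> > 0" "W \<ge> 0" "Z \<ge> 0"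
  shows "W * Z \<le> \<epsilon> * Z powr (S / (S - 1)) + \<epsilon> powr (1 - S) * W powr S"
proof (cases "W = 0 \<or> Z = 0")
  case True
  then show ?thesis using assms by auto
next
  case False
  with assms have W: "W > 0" and Z: "Z > 0" by auto
  define T where "T = S / (S - 1)"
  have T1: "T - 1 = 1 / (S - 1)" using assms by (simp add: T_def field_simps)
  have eqZ: "Z * Z powr (T - 1) = Z powr T"
    using Z by (metis powr_mult_base less_imp_le add_diff_cancel_left' diff_add_cancel add.commute)
  have eqW: "W * W powr (S - 1) = W powr S"
    using W by (metis powr_mult_base less_imp_le add.commute diff_add_cancel)
  show ?thesis
  proof (cases "W \<le> \<epsilon> * Z powr (T - 1)")
    case True
    then have "W * Z \<le> \<epsilon> * Z powr (T - 1) * Z" using Z by simp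
    also have "\<dots> = \<epsilon> * Z powr T" using eqZ by (simp add: mult.commute mult.left_commute)
    finally show ?thesis unfolding T_def using assms by (simp add: add_increasing2)
  next
    case False
    then have "Z powr (T - 1) \<le> W / \<epsilon>" using assms by (simp add: field_simps)
    then have "(Z powr (T - 1)) powr (S - 1) \<le> (W / \<epsilon>) powr (S - 1)"
      using assms by (intro powr_mono2) auto
    moreover have "(Z powr (T - 1)) powr (S - 1) = Z"
      using assms Z by (simp add: powr_powr T1)
    moreover have "(W / \<epsilon>) powr (S - 1) = W powr (S - 1) * \<epsilon> powr (1 - S)"
      using assms W by (simp add: powr_divide powr_diff)
    ultimately have "Z \<le> W powr (S - 1) * \<epsilon> powr (1 - S)" by simp
    then have "W * Z \<le> W * (W powr (S - 1) * \<epsilon> powr (1 - S))" using W by simp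
    also have "\<dots> = \<epsilon> powr (1 - S) * W powr S"
      using eqW by (simp add: mult.commute mult.left_commute)
    finally show ?thesis using assms by (simp add: add_increasing)
  qed
qed

text \<open>Once \<open>y\<close> exceeds a fixed multiple of \<open>d\<close>, the negative square
  beats the other two terms; otherwise everything is of order \<open>d powr p\<close>. This removes
  the gradient of the solution from the energy, with \<open>y\<close> standing for |Du| times the
  cutoff divided by u.\<close>

lemma quadratic_absorption:
  fixes c K K' p :: real
  assumes "c > 0" "K \<ge> 0" "K' \<ge> 0" "p \<ge> 2"
  obtains B where "B \<ge> 0"
    "\<And>y d. 0 \<le> y \<Longrightarrow> 0 < d \<Longrightarrow>
       npow y (p - 2) * (- c * y\<^sup>2 + K * y * d + K' * d\<^sup>2) \<le> B * d powr p"
proof -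
  \<comment> \<open>\<open>L \<ge> 1\<close> gives \<open>d \<le> y\<close> in the case
    \<open>y > L * d\<close>, and \<open>L * c \<ge> K + K'\<close> lets the negative square absorb
    both other terms there.\<close>
  define L where "L = max 1 ((K + K') / c)"
  have L: "L \<ge> 1" "L * c \<ge> K + K'"
    using assms by (auto simp: L_def field_simps max_def)
  show ?thesis
  proof (rule that[of "L powr (p - 2) * (K * L + K')"])
    show "0 \<le> L powr (p - 2) * (K * L + K')" using assms L by simp
  next
    fix y d :: real assume y: "0 \<le> y" and d: "0 < d"
    let ?q = "- c * y\<^sup>2 + K * y * d + K' * d\<^sup>2"
    show "npow y (p - 2) * ?q \<le> L powr (p - 2) * (K * L + K') * d powr p"
    proof (cases "y \<le> L * d")
      case True
      have dp: "d powr p = d powr (p - 2) * d\<^sup>2"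
        using d by (simp add: powr_diff)
      have "K * y * d \<le> K * L * d\<^sup>2"
        using mult_left_mono[OF True, of "K * d"] assms d by (simp add: power2_eq_square mult_ac)
      then have q: "?q \<le> (K * L + K') * d\<^sup>2"
        using assms by (simp add: algebra_simps) (smt (verit) mult_nonneg_nonneg zero_le_power2)
      have "npow y (p - 2) \<le> npow (L * d) (p - 2)"
        using True y assms by (intro npow_mono) auto
      also have "\<dots> = L powr (p - 2) * d powr (p - 2)"
        using L d by (simp add: npow_mult) (simp add: npow_def)
      finally have "npow y (p - 2) * ((K * L + K') * d\<^sup>2)
          \<le> (L powr (p - 2) * d powr (p - 2)) * ((K * L + K') * d\<^sup>2)"
        using assms L by (intro mult_right_mono) auto
      moreover have "npow y (p - 2) * ?q \<le> npow y (p - 2) * ((K * L + K') * d\<^sup>2)"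
        using q by (intro mult_left_mono) auto
      ultimately show ?thesis by (simp add: dp mult_ac)
    next
      case False
      then have Ld: "L * d \<le> y" by simp
      have dy: "d \<le> y" using Ld L d by (smt (verit) mult_le_cancel_right1)
      have "K * y * d + K' * d\<^sup>2 \<le> (K + K') * (y * d)"
        using mult_left_mono[OF mult_right_mono[OF dy, of d], of K'] assms d
        by (simp add: power2_eq_square algebra_simps)
      also have "\<dots> \<le> (L * c) * (y * d)" using L y d by (intro mult_right_mono) auto
      also have "\<dots> = c * y * (L * d)" by simp
      also have "\<dots> \<le> c * y * y" using Ld y assms by (intro mult_left_mono) auto
      finally have "?q \<le> 0" by (simp add: power2_eq_square)
      then have "npow y (p - 2) * ?q \<le> 0" by (simp add: mult_nonneg_nonpos)
      also have "\<dots> \<le> L powr (p - 2) * (K * L + K') * d powr p" using assms L by simp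
      finally show ?thesis .
    qed
  qed
qed

section \<open>The combined stability and weak-form inequality\<close>

text \<open>
  The integrand of the stability form at the test function \<phi>, plus \<mu> times that of the weak
  equation at v; \<Phi> and X stand for the gradients of \<phi> and v.
\<close>
definition energy_density ::
  "real \<Rightarrow> real \<Rightarrow> real \<Rightarrow> real \<Rightarrow> real \<Rightarrow> real \<Rightarrow> real \<Rightarrow> real^'n
    \<Rightarrow> real \<Rightarrow> real^'n \<Rightarrow> real \<Rightarrow> real^'n \<Rightarrow> real" where
  "energy_density p \<delta> \<gamma> \<mu> W G U \<xi> \<phi> \<Phi> v X =
     W * npow (norm \<xi>) (p - 2) * (norm \<Phi>)\<^sup>2
     + (p - 2) * (if \<xi> = 0 then 0 else W * norm \<xi> powr (p - 4) * (\<xi> \<bullet> \<Phi>)\<^sup>2)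
     - G * fnl' \<delta> \<gamma> U * \<phi>\<^sup>2
     + \<mu> * (W * npow (norm \<xi>) (p - 2) * (\<xi> \<bullet> X) - G * fnl \<delta> \<gamma> U * v)"

lemma C1_gradD:
  assumes "C1_grad u Du"
  shows "(u has_derivative (\<lambda>h. Du x \<bullet> h)) (at x)" "continuous_on UNIV u" "continuous_on UNIV Du"
  using assms by (auto simp: C1_grad_def intro: has_derivative_continuous_on)

text \<open>Near a point off the closed support the function coincides with 0, so uniqueness of
  derivatives forces its gradient to vanish there too.\<close>

lemma C1c_grad_support:
  assumes "C1c_grad \<phi> D\<phi>"
  obtains K where "compact K" "\<And>x. x \<notin> K \<Longrightarrow> \<phi> x = 0" "\<And>x. x \<notin> K \<Longrightarrow> D\<phi> x = 0"
proof
  let ?K = "closure {x. \<phi> x \<noteq> 0}"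
  show "compact ?K" using assms by (simp add: C1c_grad_def)
  show zero: "\<phi> x = 0" if "x \<notin> ?K" for x
    using that closure_subset[of "{x. \<phi> x \<noteq> 0}"] by blast
  show "D\<phi> x = 0" if "x \<notin> ?K" for x
  proof -
    have "(\<phi> has_derivative (\<lambda>h. D\<phi> x \<bullet> h)) (at x)"
      using assms by (simp add: C1c_grad_def C1_grad_def)
    then have "((\<lambda>_. 0) has_derivative (\<lambda>h. D\<phi> x \<bullet> h)) (at x)"
    proof (rule has_derivative_transform_within_open)
      show "open (- ?K)" by blast
      show "\<phi> y = 0" if "y \<in> - ?K" for y using zero[of y] that by blast
    qed (use that in blast)
    then have "(\<lambda>h. D\<phi> x \<bullet> h) = (\<lambda>h. 0)"
      by (rule has_derivative_unique) (rule has_derivative_const)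
    then have "D\<phi> x \<bullet> D\<phi> x = 0" by meson
    then show ?thesis by simp
  qed
qed

lemma borel_measurable_lebesgue_continuous:
  fixes f :: "real^'n \<Rightarrow> 'b::topological_space"
  shows "continuous_on UNIV f \<Longrightarrow> f \<in> borel_measurable lebesgue"
  by (intro measurable_completion) (simp add: borel_measurable_continuous_onI)

lemma L1_loc_mult_integrable:
  fixes w h :: "real^'n \<Rightarrow> real"
  assumes w: "L1_loc w" and h: "h \<in> borel_measurable lebesgue" and "compact K"
    and B: "\<And>x. x \<in> K \<Longrightarrow> \<bar>h x\<bar> \<le> B" and out: "\<And>x. x \<notin> K \<Longrightarrow> h x = 0"
  shows "integrable lebesgue (\<lambda>x. w x * h x)"
proof (rule Bochner_Integration.integrable_bound)
  show "integrable lebesgue (\<lambda>x. B * (indicator K x *\<^sub>R w x))"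
    using w \<open>compact K\<close> by (auto simp: L1_loc_def set_integrable_def)
  show "(\<lambda>x. w x * h x) \<in> borel_measurable lebesgue"
    using w h by (auto simp: L1_loc_def)
  show "AE x in lebesgue. norm (w x * h x) \<le> norm (B * (indicator K x *\<^sub>R w x))"
  proof (intro AE_I2)
    fix x
    show "norm (w x * h x) \<le> norm (B * (indicator K x *\<^sub>R w x))"
    proof (cases "x \<in> K")
      case True
      then have "\<bar>h x\<bar> \<le> \<bar>B\<bar>" using B[of x] by linarith
      then show ?thesis using True by (simp add: abs_mult mult.commute mult_right_mono)
    qed (simp add: out)
  qed
qed

lemma L1_loc_mult_continuous_integrable:
  fixes w h :: "real^'n \<Rightarrow> real"
  assumes "L1_loc w" and h: "continuous_on UNIV h" and "compact K"
    and "\<And>x. x \<notin> K \<Longrightarrow> h x = 0"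
  shows "integrable lebesgue (\<lambda>x. w x * h x)"
proof -
  have "bounded (h ` K)"
    using \<open>compact K\<close> h by (intro compact_imp_bounded compact_continuous_image)
      (auto intro: continuous_on_subset)
  then obtain B where "\<And>x. x \<in> K \<Longrightarrow> \<bar>h x\<bar> \<le> B" by (auto simp: bounded_iff)
  with assms show ?thesis
    by (intro L1_loc_mult_integrable[where K = K and B = B] borel_measurable_lebesgue_continuous) auto
qed

text \<open>A Bochner integral of a non-integrable function is 0 by convention, so the separate
  integrals in the hypotheses may be combined only after each integrand is shown integrable. The
  sign of \<open>\<mu>\<close> is free because the weak form is an equation.\<close>

lemma energy_density_integral_nonneg:
  fixes w g u :: "real^'n \<Rightarrow> real" and \<mu> :: real
  assumes p: "p \<ge> 2" and w: "L1_loc w" and g: "L1_loc g"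
    and u: "C1_grad u Du" and pos: "\<And>x. u x > 0"
    and weak: "weak_solution p \<delta> \<gamma> w g u Du" and stab: "stable p \<delta> \<gamma> w g u Du"
    and \<phi>: "C1c_grad \<phi> D\<phi>" and v: "C1c_grad v Dv"
  defines "E \<equiv> \<lambda>x. energy_density p \<delta> \<gamma> \<mu> (w x) (g x) (u x) (Du x) (\<phi> x) (D\<phi> x) (v x) (Dv x)"
  shows "integrable lebesgue E" "(\<integral>x. E x \<partial>lebesgue) \<ge> 0"
proof -
  let ?N = "\<lambda>x. npow (norm (Du x)) (p - 2)"
  obtain K where K: "compact K" "\<And>x. x \<notin> K \<Longrightarrow> \<phi> x = 0" "\<And>x. x \<notin> K \<Longrightarrow> D\<phi> x = 0"
    using C1c_grad_support[OF \<phi>] by blast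
  obtain L where L: "compact L" "\<And>x. x \<notin> L \<Longrightarrow> v x = 0" "\<And>x. x \<notin> L \<Longrightarrow> Dv x = 0"
    using C1c_grad_support[OF v] by blast
  note out = K(2,3) L(2,3)
  have C\<phi>: "C1_grad \<phi> D\<phi>" and Cv: "C1_grad v Dv" using \<phi> v by (auto simp: C1c_grad_def)
  note cont = C1_gradD(2,3)[OF u] C1_gradD(2,3)[OF C\<phi>] C1_gradD(2,3)[OF Cv]
  have N: "continuous_on UNIV ?N" using p cont by (intro continuous_on_npow_norm) auto
  have f: "continuous_on UNIV (\<lambda>x. fnl \<delta> \<gamma> (u x))" "continuous_on UNIV (\<lambda>x. fnl' \<delta> \<gamma> (u x))"
    unfolding fnl_def fnl'_def using cont pos
    by (auto intro!: continuous_intros simp: less_imp_neq[symmetric])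
  let ?h1 = "\<lambda>x. ?N x * (norm (D\<phi> x))\<^sup>2"
  let ?h2 = "\<lambda>x. if Du x = 0 then 0 else norm (Du x) powr (p - 4) * (Du x \<bullet> D\<phi> x)\<^sup>2"
  have c1: "continuous_on UNIV ?h1" using N cont by (intro continuous_intros)
  have i1: "integrable lebesgue (\<lambda>x. w x * ?h1 x)"
    using out c1 by (intro L1_loc_mult_continuous_integrable[OF w _ K(1)]) auto
  \<comment> \<open>Cauchy-Schwarz turns the exponent p - 4, possibly singular at zeros of
    \<open>Du\<close>, into p - 2.\<close>
  have h2h1: "\<bar>?h2 x\<bar> \<le> ?h1 x" for x
  proof (cases "Du x = 0")
    case False
    have "(Du x \<bullet> D\<phi> x)\<^sup>2 \<le> (norm (Du x) * norm (D\<phi> x))\<^sup>2"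
      using Cauchy_Schwarz_ineq2 by (intro power2_le_iff_abs_le[THEN iffD2]) auto
    then have "norm (Du x) powr (p - 4) * (Du x \<bullet> D\<phi> x)\<^sup>2
        \<le> norm (Du x) powr (p - 4) * (norm (Du x) * norm (D\<phi> x))\<^sup>2"
      by (intro mult_left_mono) auto
    also have "\<dots> = (norm (Du x) powr (p - 4) * norm (Du x) powr 2) * (norm (D\<phi> x))\<^sup>2"
      using False by (simp add: power_mult_distrib)
    also have "\<dots> = ?h1 x"
      using False unfolding powr_add[symmetric] by (simp add: npow_def)
    finally show ?thesis using False by simp
  qed simp
  obtain B where B: "\<And>x. x \<in> K \<Longrightarrow> \<bar>?h1 x\<bar> \<le> B"
    using compact_imp_bounded[OF compact_continuous_image[OF continuous_on_subset[OF c1] K(1)]]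
    unfolding bounded_iff by auto
  \<comment> \<open>For p = 2 this integrand can jump where \<open>Du\<close> vanishes, so it is
    handled as a measurable function dominated by \<open>?h1\<close>, not as a continuous
    one.\<close>
  have i2': "integrable lebesgue (\<lambda>x. w x * ?h2 x)"
  proof (rule L1_loc_mult_integrable[OF w _ K(1)])
    have [measurable]: "Du \<in> borel_measurable borel" "D\<phi> \<in> borel_measurable borel"
      using cont by (auto intro: borel_measurable_continuous_onI)
    have "?h2 \<in> borel_measurable borel" by measurable
    then show "?h2 \<in> borel_measurable lebesgue" by (intro measurable_completion) simp
    show "\<bar>?h2 x\<bar> \<le> B" if "x \<in> K" for x using h2h1[of x] B[OF that] by linarith
    show "?h2 x = 0" if "x \<notin> K" for x using out that by simp
  qed
  have eq2: "(\<lambda>x. w x * ?h2 x)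
      = (\<lambda>x. if Du x = 0 then 0 else w x * norm (Du x) powr (p - 4) * (Du x \<bullet> D\<phi> x)\<^sup>2)"
    by auto
  note i2 = i2'[unfolded eq2]
  have i3: "integrable lebesgue (\<lambda>x. g x * (fnl' \<delta> \<gamma> (u x) * (\<phi> x)\<^sup>2))"
    using out f cont by (intro L1_loc_mult_continuous_integrable[OF g _ K(1)] continuous_intros) auto
  have i4: "integrable lebesgue (\<lambda>x. w x * (?N x * (Du x \<bullet> Dv x)))"
    using out N cont by (intro L1_loc_mult_continuous_integrable[OF w _ L(1)] continuous_intros) auto
  have i5: "integrable lebesgue (\<lambda>x. g x * (fnl \<delta> \<gamma> (u x) * v x))"
    using out f cont by (intro L1_loc_mult_continuous_integrable[OF g _ L(1)] continuous_intros) auto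
  note ints = i1[folded mult.assoc] i2 i3[folded mult.assoc] i4[folded mult.assoc] i5[folded mult.assoc]
  note hb = ints[THEN has_bochner_integral_integrable]
  have E: "has_bochner_integral lebesgue E
     ((\<integral>x. w x * ?N x * (norm (D\<phi> x))\<^sup>2 \<partial>lebesgue)
      + (p - 2) * (\<integral>x. (if Du x = 0 then 0
              else w x * norm (Du x) powr (p - 4) * (Du x \<bullet> D\<phi> x)\<^sup>2) \<partial>lebesgue)
      - (\<integral>x. g x * fnl' \<delta> \<gamma> (u x) * (\<phi> x)\<^sup>2 \<partial>lebesgue)
      + \<mu> * ((\<integral>x. w x * ?N x * (Du x \<bullet> Dv x) \<partial>lebesgue) - (\<integral>x. g x * fnl \<delta> \<gamma> (u x) * v x \<partial>lebesgue)))"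
    unfolding E_def energy_density_def
    by (rule has_bochner_integral_add[OF has_bochner_integral_diff[OF has_bochner_integral_add[OF
            hb(1) has_bochner_integral_mult_right[OF hb(2)]] hb(3)]
          has_bochner_integral_mult_right[OF has_bochner_integral_diff[OF hb(4,5)]]])
  show "integrable lebesgue E" using E by (simp add: has_bochner_integral_iff)
  \<comment> \<open>The stability form is nonnegative, and the bracket multiplied by
    \<open>\<mu>\<close> is 0.\<close>
  show "(\<integral>x. E x \<partial>lebesgue) \<ge> 0"
    unfolding has_bochner_integral_integral_eq[OF E]
    using weak stab \<phi> v unfolding weak_solution_def stable_def by auto
qed

section \<open>Cutoff functions and calculus of C^1 test functions\<close>

text \<open>At 0 the difference quotient is bounded by |h| powr (k - 1), which tends to 0 because k
  > 1; elsewhere the function is locally a power or constant.\<close>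

lemma has_field_derivative_max_0_powr:
  assumes "k > 1"
  shows "((\<lambda>t::real. max 0 t powr k) has_real_derivative k * max 0 t powr (k - 1)) (at t)"
proof -
  consider "t > 0" | "t < 0" | "t = 0" by linarith
  then show ?thesis
  proof cases
    case 1
    then have "((\<lambda>t::real. t powr k) has_real_derivative k * max 0 t powr (k - 1)) (at t)"
      by (auto intro!: derivative_eq_intros)
    then show ?thesis
      by (rule has_field_derivative_transform_within_open[where S = "{0<..}"]) (use 1 in auto)
  next
    case 2
    then have "((\<lambda>t::real. 0) has_real_derivative k * max 0 t powr (k - 1)) (at t)"
      by simp
    then show ?thesis
      by (rule has_field_derivative_transform_within_open[where S = "{..<0}"]) (use 2 in auto)
  next
    case 3
    have lim: "((\<lambda>h::real. \<bar>h\<bar> powr (k - 1)) \<longlongrightarrow> \<bar>0\<bar> powr (k - 1)) (at 0)"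
      using assms by (intro tendsto_powr' tendsto_intros) (auto simp: eventually_at_filter)
    have bound: "norm (max 0 h powr k / h) \<le> \<bar>h\<bar> powr (k - 1)" for h :: real
    proof (cases "h > 0")
      case True
      then show ?thesis by (simp add: powr_diff)
    next
      case False
      then show ?thesis by simp
    qed
    have "((\<lambda>h::real. max 0 h powr k / h) \<longlongrightarrow> 0) (at 0)"
      by (rule Lim_null_comparison[OF _ lim[simplified]]) (use bound in auto)
    then show ?thesis using 3 by (simp add: DERIV_def)
  qed
qed

text \<open>Only powers with exponent above 1 serve as test factors: these are C^1 with an explicit
  gradient, although \<open>cutoff\<close> itself has a kink on the sphere of radius 2R. A plateau
  of value 1 is replaced by a positive lower bound on the unit ball.\<close>

definition cutoff :: "real \<Rightarrow> real^'n \<Rightarrow> real" where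
  "cutoff R x = max 0 (1 - (norm x)\<^sup>2 / (4 * R\<^sup>2))"

lemma cutoff_nonneg: "0 \<le> cutoff R x"
  by (simp add: cutoff_def)

lemma cutoff_pos_iff: "R > 0 \<Longrightarrow> 0 < cutoff R x \<longleftrightarrow> x \<in> ball 0 (2 * R)"
proof -
  assume R: "R > 0"
  have "0 < cutoff R x \<longleftrightarrow> (norm x)\<^sup>2 < (2 * R)\<^sup>2"
    using R by (auto simp: cutoff_def less_max_iff_disj power_mult_distrib)
  also have "\<dots> \<longleftrightarrow> norm x < 2 * R"
    using R by (smt (verit) norm_ge_zero power2_less_imp_less power_strict_mono zero_less_numeral)
  finally show ?thesis by simp
qed

lemma cutoff_ge:
  assumes "R \<ge> 1" "norm x \<le> 1" shows "cutoff R x \<ge> 3 / 4"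
proof -
  have x: "(norm x)\<^sup>2 \<le> 1" and R: "R\<^sup>2 \<ge> 1" using assms by (auto simp: power_le_one)
  have "(norm x)\<^sup>2 / (4 * R\<^sup>2) \<le> 1 / (4 * 1)" using x R by (intro frac_le) auto
  then show ?thesis by (simp add: cutoff_def)
qed

lemma C1_grad_cutoff_powr:
  assumes "k > 1"
  shows "C1_grad (\<lambda>x. cutoff R x powr k) (\<lambda>x. (- (k * cutoff R x powr (k - 1) / (2 * R\<^sup>2))) *\<^sub>R x)"
  unfolding C1_grad_def
proof (intro conjI allI)
  fix x :: "real^'n"
  have d: "((\<lambda>x::real^'n. 1 - (norm x)\<^sup>2 / (4 * R\<^sup>2)) has_derivative
      (\<lambda>h. - (2 * (x \<bullet> h)) / (4 * R\<^sup>2))) (at x)"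
  proof -
    have "((\<lambda>x::real^'n. 1 - (x \<bullet> x) * c) has_derivative (\<lambda>h. - (2 * (x \<bullet> h)) * c)) (at x)" for c
      by (auto intro!: derivative_eq_intros simp: inner_commute)
    then show ?thesis unfolding power2_norm_eq_inner divide_inverse .
  qed
  show "((\<lambda>x. cutoff R x powr k) has_derivative
      (\<lambda>h. (- (k * cutoff R x powr (k - 1) / (2 * R\<^sup>2))) *\<^sub>R x \<bullet> h)) (at x)"
    unfolding cutoff_def
    using has_derivative_compose[OF d
        has_field_derivative_max_0_powr[OF assms, unfolded has_field_derivative_def]]
    by (rule has_derivative_eq_rhs) (auto simp: field_simps)
next
  show "continuous_on UNIV (\<lambda>x::real^'n. (- (k * cutoff R x powr (k - 1) / (2 * R\<^sup>2))) *\<^sub>R x)"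
    unfolding cutoff_def divide_inverse using assms
    by (intro continuous_intros continuous_on_powr' continuous_on_max) auto
qed

text \<open>Where the cutoff is positive, |x| is at most 2R, which cancels one factor R; where it
  vanishes, \<open>0 powr (k - 1)\<close> is 0. The bound has the shape required of
  \<open>\<zeta>\<close> in the pointwise estimate, with \<open>d\<close> equal to 1/R.\<close>

lemma norm_cutoff_powr_grad_le:
  assumes "R > 0" "k > 0"
  shows "norm ((- (k * cutoff R x powr (k - 1) / (2 * R\<^sup>2))) *\<^sub>R x)
    \<le> k * cutoff R x powr (k - 1) * (1 / R)"
proof (cases "cutoff R x = 0")
  case False
  then have "norm x \<le> 2 * R"
    using cutoff_pos_iff[OF \<open>R > 0\<close>, of x] cutoff_nonneg[of R x] by auto
  then have "k * cutoff R x powr (k - 1) / (2 * R\<^sup>2) * norm x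
      \<le> k * cutoff R x powr (k - 1) / (2 * R\<^sup>2) * (2 * R)"
    using assms by (intro mult_left_mono) auto
  then show ?thesis using assms by (simp add: abs_mult power2_eq_square)
qed simp

lemma C1_grad_mult:
  assumes "C1_grad f Df" "C1_grad h Dh"
  shows "C1_grad (\<lambda>x. f x * h x) (\<lambda>x. h x *\<^sub>R Df x + f x *\<^sub>R Dh x)"
  unfolding C1_grad_def
proof (intro conjI allI)
  fix x
  show "((\<lambda>x. f x * h x) has_derivative (\<lambda>y. (h x *\<^sub>R Df x + f x *\<^sub>R Dh x) \<bullet> y)) (at x)"
    using has_derivative_mult[OF C1_gradD(1)[OF assms(1)] C1_gradD(1)[OF assms(2)]]
    by (rule has_derivative_eq_rhs) (auto simp: algebra_simps inner_add_left)
qed (use C1_gradD(2,3)[OF assms(1)] C1_gradD(2,3)[OF assms(2)] in \<open>auto intro!: continuous_intros\<close>)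

lemma C1_grad_powr:
  assumes "C1_grad u Du" "\<And>x. u x > 0"
  shows "C1_grad (\<lambda>x. u x powr a) (\<lambda>x. (a * u x powr (a - 1)) *\<^sub>R Du x)"
  unfolding C1_grad_def
proof (intro conjI allI)
  fix x
  have "((\<lambda>t. t powr a) has_derivative (\<lambda>h. a * u x powr (a - 1) * h)) (at (u x))"
    using assms(2)[of x] by (auto intro!: derivative_eq_intros simp: has_field_derivative_def[symmetric])
  from has_derivative_compose[OF C1_gradD(1)[OF assms(1)] this]
  show "((\<lambda>x. u x powr a) has_derivative (\<lambda>h. (a * u x powr (a - 1)) *\<^sub>R Du x \<bullet> h)) (at x)"
    by (rule has_derivative_eq_rhs) auto
next
  have "u x \<noteq> 0" for x using assms(2)[of x] by simp
  then show "continuous_on UNIV (\<lambda>x. (a * u x powr (a - 1)) *\<^sub>R Du x)"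
    using C1_gradD(2,3)[OF assms(1)] by (auto intro!: continuous_intros)
qed

section \<open>Pointwise bound on the energy density\<close>

text \<open>
  Here \<xi> is Du, d bounds |D\<psi>|, and \<zeta> is the gradient of \<psi> powr (pS/2). This power is the one for
  which the cutoff factors on both sides of Young's inequality with exponent S agree.
\<close>
lemma pointwise_estimate:
  fixes p \<delta> \<gamma> \<alpha> \<mu> S M :: real
  assumes p: "p \<ge> 2" and \<delta>: "0 < \<delta>" "\<delta> < \<gamma>" and M: "M > 0"
    and \<mu>: "(p - 1) * \<alpha>\<^sup>2 < \<mu> * (2 * \<alpha> + 1)" "0 < \<mu>" "\<mu> < \<delta>"
    and S: "S > 1" "(S - 1) * (\<delta> + p - 1) = 2 * \<alpha> + 2 - p"
  obtains B where "B \<ge> 0"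
    "\<And>W G U \<psi> d \<xi> \<zeta>. \<lbrakk>W > 0; G \<ge> 1 / M; U > 0; \<psi> > 0; d > 0;
        norm \<zeta> \<le> p * S / 2 * \<psi> powr (p * S / 2 - 1) * d\<rbrakk> \<Longrightarrow>
      energy_density p \<delta> \<gamma> \<mu> W G U (\<xi>::real^'n)
        (U powr (- \<alpha>) * \<psi> powr (p * S / 2))
        (\<psi> powr (p * S / 2) *\<^sub>R (- \<alpha> * U powr (- \<alpha> - 1)) *\<^sub>R \<xi> + U powr (- \<alpha>) *\<^sub>R \<zeta>)
        (U powr (- 2 * \<alpha> - 1) * (\<psi> powr (p * S / 2) * \<psi> powr (p * S / 2)))
        ((\<psi> powr (p * S / 2) * \<psi> powr (p * S / 2)) *\<^sub>R ((- 2 * \<alpha> - 1) * U powr (- 2 * \<alpha> - 1 - 1)) *\<^sub>R \<xi>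
          + U powr (- 2 * \<alpha> - 1) *\<^sub>R (\<psi> powr (p * S / 2) *\<^sub>R \<zeta> + \<psi> powr (p * S / 2) *\<^sub>R \<zeta>))
      \<le> B * (W powr S * d powr (p * S)) - (\<delta> - \<mu>) / (2 * M) * (U powr (- \<delta> - 2 * \<alpha> - 1) * \<psi> powr (p * S))"
proof -
  define k where "k = p * S / 2"
  \<comment> \<open>Up to sign, \<open>c\<close> and \<open>K\<close> are the coefficients of the
    squared and the mixed term when the gradient contributions are expanded; \<open>c > 0\<close> is
    the first assumption on \<open>\<mu>\<close>.\<close>
  define c where "c = \<mu> * (2 * \<alpha> + 1) - (p - 1) * \<alpha>\<^sup>2"
  define K where "K = \<bar>2 * \<mu> - 2 * \<alpha> * (p - 1)\<bar>"
  have k: "k > 0" using p S by (simp add: k_def)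
  obtain A where A: "A \<ge> 0" "\<And>y d. 0 \<le> y \<Longrightarrow> 0 < d \<Longrightarrow>
       npow y (p - 2) * (- c * y\<^sup>2 + (K * k) * y * d + ((p - 1) * k\<^sup>2) * d\<^sup>2) \<le> A * d powr p"
    by (rule quadratic_absorption[of c "K * k" "(p - 1) * k\<^sup>2" p])
       (use \<mu> p k in \<open>auto simp: c_def K_def\<close>)
  \<comment> \<open>The zero-order terms will yield \<open>- 2 * \<epsilon>\<close> times the
    weighted power of U; Young's inequality spends one \<open>\<epsilon>\<close> and the other
    survives.\<close>
  define \<epsilon> where "\<epsilon> = (\<delta> - \<mu>) / (2 * M)"
  have \<epsilon>: "\<epsilon> > 0" using \<mu> M by (simp add: \<epsilon>_def)
  show ?thesis
  proof (rule that[of "\<epsilon> powr (1 - S) * A powr S"])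
    show "0 \<le> \<epsilon> powr (1 - S) * A powr S" by simp
  next
    fix W G U \<psi> d :: real and \<xi> \<zeta> :: "real^'n"
    assume W: "W > 0" and G: "G \<ge> 1 / M" and U: "U > 0" and \<psi>: "\<psi> > 0" and d: "d > 0"
      and \<zeta>: "norm \<zeta> \<le> p * S / 2 * \<psi> powr (p * S / 2 - 1) * d"
    define N where "N = npow (norm \<xi>) (p - 2)"
    define E where "E = U powr (- 2 * \<alpha>)"
    define \<eta> where "\<eta> = \<psi> powr k"
    define a where "a = norm \<xi> / U"
    define Phi where "Phi = \<eta> *\<^sub>R (- \<alpha> * U powr (- \<alpha> - 1)) *\<^sub>R \<xi> + U powr (- \<alpha>) *\<^sub>R \<zeta>"
    define X where "X = (\<eta> * \<eta>) *\<^sub>R ((- 2 * \<alpha> - 1) * U powr (- 2 * \<alpha> - 1 - 1)) *\<^sub>R \<xi>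
          + U powr (- 2 * \<alpha> - 1) *\<^sub>R (\<eta> *\<^sub>R \<zeta> + \<eta> *\<^sub>R \<zeta>)"
    have N: "N \<ge> 0" by (simp add: N_def)
    have \<eta>: "\<eta> > 0" using \<psi> by (simp add: \<eta>_def)
    have E: "E > 0" using U by (simp add: E_def)
    have a: "a \<ge> 0" "norm \<xi> = a * U" using U by (auto simp: a_def)
    have Ua: "(U powr (- \<alpha>))\<^sup>2 = E" "U powr (- \<alpha> - 1) = U powr (- \<alpha>) / U"
      "U powr (- 2 * \<alpha> - 1) = E / U" "U powr (- 2 * \<alpha> - 1 - 1) = E / U\<^sup>2"
    proof -
      have "U powr (- 2 * \<alpha> - 1 - 1) = U powr (- 2 * \<alpha> - 2)" by (simp add: algebra_simps)
      then show "U powr (- 2 * \<alpha> - 1 - 1) = E / U\<^sup>2"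
        using U unfolding E_def powr_diff by simp
    qed (use U in \<open>auto simp: E_def power2_eq_square powr_diff powr_add[symmetric]\<close>)
    define q where "q = (\<xi> \<bullet> \<zeta>) / U"
    have q: "\<bar>q\<bar> \<le> a * norm \<zeta>"
      using Cauchy_Schwarz_ineq2[of \<xi> \<zeta>] U by (simp add: q_def a_def field_simps)
    have Phi2: "(norm Phi)\<^sup>2 = E * (\<alpha>\<^sup>2 * \<eta>\<^sup>2 * a\<^sup>2 - 2 * \<alpha> * \<eta> * q + (norm \<zeta>)\<^sup>2)"
    proof -
      have "Phi = U powr (- \<alpha>) *\<^sub>R (\<zeta> - (\<alpha> * \<eta> / U) *\<^sub>R \<xi>)"
        unfolding Phi_def Ua by (simp add: algebra_simps)
      then have "(norm Phi)\<^sup>2 = E * (norm (\<zeta> - (\<alpha> * \<eta> / U) *\<^sub>R \<xi>))\<^sup>2"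
        by (simp add: power_mult_distrib Ua)
      also have "(norm (\<zeta> - (\<alpha> * \<eta> / U) *\<^sub>R \<xi>))\<^sup>2
          = (norm \<zeta>)\<^sup>2 - 2 * (\<alpha> * \<eta> / U) * (\<xi> \<bullet> \<zeta>) + (\<alpha> * \<eta> / U)\<^sup>2 * (norm \<xi>)\<^sup>2"
        unfolding power2_norm_eq_inner
        by (simp add: inner_diff_left inner_diff_right inner_commute power2_eq_square algebra_simps)
      also have "\<dots> = \<alpha>\<^sup>2 * \<eta>\<^sup>2 * a\<^sup>2 - 2 * \<alpha> * \<eta> * q + (norm \<zeta>)\<^sup>2"
        by (simp add: q_def a_def power_mult_distrib power_divide)
      finally show ?thesis .
    qed
    have XX: "\<xi> \<bullet> X = E * (- (2 * \<alpha> + 1) * \<eta>\<^sup>2 * a\<^sup>2 + 2 * \<eta> * q)"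
      unfolding X_def Ua q_def a_def inner_add_right inner_scaleR_right
        power2_norm_eq_inner[of \<xi>, symmetric] using U
      by (simp add: field_simps power2_eq_square)
    \<comment> \<open>By Cauchy-Schwarz the two gradient terms of the stability form together cost
      at most p - 1 copies of the first.\<close>
    have P2: "(if \<xi> = 0 then 0 else W * norm \<xi> powr (p - 4) * (\<xi> \<bullet> Phi)\<^sup>2) \<le> W * N * (norm Phi)\<^sup>2"
    proof (cases "\<xi> = 0")
      case False
      have "(\<xi> \<bullet> Phi)\<^sup>2 \<le> (norm \<xi> * norm Phi)\<^sup>2"
        using Cauchy_Schwarz_ineq2 by (intro power2_le_iff_abs_le[THEN iffD2]) auto
      then have "W * norm \<xi> powr (p - 4) * (\<xi> \<bullet> Phi)\<^sup>2
          \<le> W * norm \<xi> powr (p - 4) * (norm \<xi> * norm Phi)\<^sup>2"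
        using W by (intro mult_left_mono) auto
      also have "\<dots> = W * (norm \<xi> powr (p - 4) * norm \<xi> powr 2) * (norm Phi)\<^sup>2"
        using False by (simp add: power_mult_distrib)
      also have "\<dots> = W * N * (norm Phi)\<^sup>2"
        using False unfolding powr_add[symmetric] by (simp add: npow_def N_def)
      finally show ?thesis using False by simp
    qed (use W N in auto)
    \<comment> \<open>The bound on \<open>\<zeta>\<close> carries a factor
      \<open>\<eta> / \<psi>\<close>; scaling \<open>a\<close> by \<open>\<psi>\<close> makes this
      factor common, leaving a quadratic form in \<open>y\<close> and \<open>d\<close>.\<close>
    define y where "y = a * \<psi>"
    have y: "y \<ge> 0" using a \<psi> by (simp add: y_def)
    have \<zeta>': "norm \<zeta> \<le> k * \<eta> / \<psi> * d" using \<zeta> \<psi> by (simp add: k_def[symmetric] \<eta>_def powr_diff)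
    have grad: "(p - 1) * (norm Phi)\<^sup>2 + \<mu> * (\<xi> \<bullet> X)
        \<le> E * \<eta>\<^sup>2 / \<psi>\<^sup>2 * (- c * y\<^sup>2 + (K * k) * y * d + ((p - 1) * k\<^sup>2) * d\<^sup>2)"
    proof -
      have "(2 * \<mu> - 2 * \<alpha> * (p - 1)) * q \<le> K * \<bar>q\<bar>"
        unfolding K_def abs_mult[symmetric] by simp
      also have "\<dots> \<le> K * (a * (k * \<eta> / \<psi> * d))"
        using q mult_left_mono[OF \<zeta>' a(1)] by (intro mult_left_mono) (auto simp: K_def)
      finally have cross: "(2 * \<mu> - 2 * \<alpha> * (p - 1)) * q * \<eta> \<le> K * (a * (k * \<eta> / \<psi> * d)) * \<eta>"
        using \<eta> by (intro mult_right_mono) auto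
      have "(norm \<zeta>)\<^sup>2 \<le> (k * \<eta> / \<psi> * d)\<^sup>2" using \<zeta>' by (intro power_mono) auto
      then have rem: "(p - 1) * (norm \<zeta>)\<^sup>2 \<le> (p - 1) * (k * \<eta> / \<psi> * d)\<^sup>2"
        using p by (intro mult_left_mono) auto
      have "(p - 1) * (norm Phi)\<^sup>2 + \<mu> * (\<xi> \<bullet> X)
          = E * (- c * a\<^sup>2 * \<eta>\<^sup>2 + (2 * \<mu> - 2 * \<alpha> * (p - 1)) * q * \<eta> + (p - 1) * (norm \<zeta>)\<^sup>2)"
        unfolding Phi2 XX c_def by (simp add: algebra_simps)
      also have "\<dots> \<le> E * (- c * a\<^sup>2 * \<eta>\<^sup>2 + K * (a * (k * \<eta> / \<psi> * d)) * \<eta> + (p - 1) * (k * \<eta> / \<psi> * d)\<^sup>2)"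
        using E cross rem by (intro mult_left_mono) auto
      also have "\<dots> = E * \<eta>\<^sup>2 / \<psi>\<^sup>2 * (- c * y\<^sup>2 + (K * k) * y * d + ((p - 1) * k\<^sup>2) * d\<^sup>2)"
        using \<psi> by (simp add: y_def field_simps power2_eq_square)
      finally show ?thesis .
    qed
    have NN: "N = npow y (p - 2) * (U / \<psi>) powr (p - 2)"
    proof -
      have "norm \<xi> = y * (U / \<psi>)" using \<psi> a by (simp add: y_def)
      then show ?thesis unfolding N_def using y U \<psi> by (simp only: npow_mult divide_pos_pos)
    qed
    \<comment> \<open>Collects all powers of U and \<open>\<psi>\<close>: the square of
      \<open>\<eta>\<close> is \<open>\<psi> powr (p * S)\<close>, and division by
      \<open>\<psi> powr p\<close> leaves the exponent p(S - 1).\<close>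
    have T: "(U / \<psi>) powr (p - 2) * (E * \<eta>\<^sup>2 / \<psi>\<^sup>2) = U powr (p - 2 - 2 * \<alpha>) * \<psi> powr (p * (S - 1))"
    proof -
      have "U powr (p - 2) * E = U powr (p - 2 - 2 * \<alpha>)"
        unfolding E_def powr_add[symmetric] by simp
      moreover have "\<eta>\<^sup>2 / (\<psi>\<^sup>2 * \<psi> powr (p - 2)) = \<psi> powr (p * (S - 1))"
      proof -
        have "\<psi>\<^sup>2 * \<psi> powr (p - 2) = \<psi> powr p" using \<psi> by (simp add: powr_diff)
        moreover have "\<eta>\<^sup>2 = \<psi> powr (p * S)"
          by (simp add: \<eta>_def power2_eq_square powr_add[symmetric] k_def mult.commute)
        ultimately show ?thesis by (simp add: powr_diff[symmetric] algebra_simps)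
      qed
      ultimately show ?thesis using U \<psi> by (simp add: powr_divide) (metis mult.commute times_divide_eq_right mult.assoc)
    qed
    define Z where "Z = U powr (p - 2 - 2 * \<alpha>) * \<psi> powr (p * (S - 1))"
    \<comment> \<open>The relation between S and \<open>\<alpha>\<close> enters here: it makes the
      conjugate power of \<open>Z\<close> exactly the weighted power of U in the zero-order
      term.\<close>
    have ZS: "Z powr (S / (S - 1)) = U powr (- \<delta> - 2 * \<alpha> - 1) * \<psi> powr (p * S)"
    proof -
      have "(p - 2 - 2 * \<alpha>) * (S / (S - 1)) = - \<delta> - 2 * \<alpha> - 1"
      proof -
        have "(p - 2 - 2 * \<alpha>) * (S / (S - 1)) = - (\<delta> + p - 1) * S"
          using S by (simp add: field_simps)
        also have "\<dots> = - ((S - 1) * (\<delta> + p - 1)) - (\<delta> + p - 1)" by (simp add: algebra_simps)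
        finally show ?thesis unfolding S(2) by simp
      qed
      moreover have "p * (S - 1) * (S / (S - 1)) = p * S" using S by simp
      ultimately show ?thesis unfolding Z_def using U \<psi> by (simp only: powr_mult powr_powr powr_ge_zero)
    qed
    have "W * (N * ((p - 1) * (norm Phi)\<^sup>2 + \<mu> * (\<xi> \<bullet> X)))
        \<le> W * (N * (E * \<eta>\<^sup>2 / \<psi>\<^sup>2 * (- c * y\<^sup>2 + (K * k) * y * d + ((p - 1) * k\<^sup>2) * d\<^sup>2)))"
      using W N grad by (intro mult_left_mono) auto
    also have "\<dots> = W * (Z * (npow y (p - 2) * (- c * y\<^sup>2 + (K * k) * y * d + ((p - 1) * k\<^sup>2) * d\<^sup>2)))"
      unfolding Z_def T[symmetric] NN by (simp only: mult_ac)
    also have "\<dots> \<le> W * (Z * (A * d powr p))"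
      using A(2)[OF y d] W by (intro mult_left_mono) (auto simp: Z_def)
    also have "\<dots> = (A * (W * d powr p)) * Z" by simp
    also have "\<dots> \<le> \<epsilon> * Z powr (S / (S - 1)) + \<epsilon> powr (1 - S) * (A * (W * d powr p)) powr S"
      using S \<epsilon> A W by (intro young_powr) (auto simp: Z_def)
    also have "(A * (W * d powr p)) powr S = A powr S * (W powr S * d powr (p * S))"
      using A W by (simp add: powr_mult powr_powr)
    finally have main: "W * (N * ((p - 1) * (norm Phi)\<^sup>2 + \<mu> * (\<xi> \<bullet> X)))
      \<le> \<epsilon> * (U powr (- \<delta> - 2 * \<alpha> - 1) * \<psi> powr (p * S))
         + \<epsilon> powr (1 - S) * (A powr S * (W powr S * d powr (p * S)))"
      unfolding ZS .
    \<comment> \<open>Since \<open>fnl\<close> is negative, the weak form lowers both coefficients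
      \<open>\<delta>\<close> and \<open>\<gamma>\<close> by \<open>\<mu>\<close>. The
      \<open>\<gamma>\<close> part keeps a favourable sign, as
      \<open>\<mu> < \<delta> < \<gamma>\<close>, and is dropped; the lower bound on G does the
      rest.\<close>
    have gpart: "- G * fnl' \<delta> \<gamma> U * (U powr (- \<alpha>) * \<eta>)\<^sup>2
        - \<mu> * (G * fnl \<delta> \<gamma> U * (U powr (- 2 * \<alpha> - 1) * (\<eta> * \<eta>)))
      \<le> - 2 * \<epsilon> * (U powr (- \<delta> - 2 * \<alpha> - 1) * \<psi> powr (p * S))"
    proof -
      have \<eta>2: "\<eta>\<^sup>2 = \<psi> powr (p * S)"
          by (simp add: \<eta>_def power2_eq_square powr_add[symmetric] k_def mult.commute)
      have e: "U powr (- \<delta> - 2 * \<alpha> - 1) = U powr (-\<delta>) * E / U"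
        using U unfolding E_def powr_add[symmetric] by (simp add: powr_diff)
      have G0: "G > 0" using G M by (smt (verit) divide_pos_pos)
      have "- G * fnl' \<delta> \<gamma> U * (U powr (- \<alpha>) * \<eta>)\<^sup>2
        - \<mu> * (G * fnl \<delta> \<gamma> U * (U powr (- 2 * \<alpha> - 1) * (\<eta> * \<eta>)))
        = - ((\<delta> - \<mu>) * U powr (-\<delta>) + (\<gamma> - \<mu>) * U powr (-\<gamma>)) * (G * (E * \<eta>\<^sup>2 / U))"
        using U unfolding power_mult_distrib Ua unfolding fnl_def fnl'_def powr_diff
        by (simp add: field_simps power2_eq_square)
      also have "\<dots> \<le> - ((\<delta> - \<mu>) * U powr (-\<delta>)) * (G * (E * \<eta>\<^sup>2 / U))"
        using G0 E U \<mu> \<delta> by (intro mult_right_mono) auto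
      also have "\<dots> = - (G * ((\<delta> - \<mu>) * (U powr (-\<delta>) * E / U * \<eta>\<^sup>2)))" by simp
      also have "\<dots> \<le> - (1 / M * ((\<delta> - \<mu>) * (U powr (-\<delta>) * E / U * \<eta>\<^sup>2)))"
        using G E U \<mu> unfolding neg_le_iff_le by (intro mult_right_mono) auto
      also have "\<dots> = - 2 * \<epsilon> * (U powr (- \<delta> - 2 * \<alpha> - 1) * \<psi> powr (p * S))"
        unfolding e \<eta>2 \<epsilon>_def using M U by (simp add: field_simps)
      finally show ?thesis .
    qed
    have "energy_density p \<delta> \<gamma> \<mu> W G U \<xi> (U powr (- \<alpha>) * \<eta>) Phi
        (U powr (- 2 * \<alpha> - 1) * (\<eta> * \<eta>)) X
      \<le> W * N * (norm Phi)\<^sup>2 + (p - 2) * (W * N * (norm Phi)\<^sup>2) - G * fnl' \<delta> \<gamma> U * (U powr (- \<alpha>) * \<eta>)\<^sup>2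
        + \<mu> * (W * N * (\<xi> \<bullet> X) - G * fnl \<delta> \<gamma> U * (U powr (- 2 * \<alpha> - 1) * (\<eta> * \<eta>)))"
      unfolding energy_density_def N_def[symmetric]
      using mult_left_mono[OF P2, of "p - 2"] p by simp
    also have "\<dots> = W * (N * ((p - 1) * (norm Phi)\<^sup>2 + \<mu> * (\<xi> \<bullet> X)))
        + (- G * fnl' \<delta> \<gamma> U * (U powr (- \<alpha>) * \<eta>)\<^sup>2
        - \<mu> * (G * fnl \<delta> \<gamma> U * (U powr (- 2 * \<alpha> - 1) * (\<eta> * \<eta>))))"
      by (simp add: algebra_simps)
    also have "\<dots> \<le> \<epsilon> powr (1 - S) * A powr S * (W powr S * d powr (p * S))
        - \<epsilon> * (U powr (- \<delta> - 2 * \<alpha> - 1) * \<psi> powr (p * S))"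
      using main gpart by (simp add: algebra_simps)
    finally show "energy_density p \<delta> \<gamma> \<mu> W G U \<xi>
        (U powr (- \<alpha>) * \<psi> powr (p * S / 2))
        (\<psi> powr (p * S / 2) *\<^sub>R (- \<alpha> * U powr (- \<alpha> - 1)) *\<^sub>R \<xi> + U powr (- \<alpha>) *\<^sub>R \<zeta>)
        (U powr (- 2 * \<alpha> - 1) * (\<psi> powr (p * S / 2) * \<psi> powr (p * S / 2)))
        ((\<psi> powr (p * S / 2) * \<psi> powr (p * S / 2)) *\<^sub>R ((- 2 * \<alpha> - 1) * U powr (- 2 * \<alpha> - 1 - 1)) *\<^sub>R \<xi>
          + U powr (- 2 * \<alpha> - 1) *\<^sub>R (\<psi> powr (p * S / 2) *\<^sub>R \<zeta> + \<psi> powr (p * S / 2) *\<^sub>R \<zeta>))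
      \<le> \<epsilon> powr (1 - S) * A powr S * (W powr S * d powr (p * S))
        - (\<delta> - \<mu>) / (2 * M) * (U powr (- \<delta> - 2 * \<alpha> - 1) * \<psi> powr (p * S))"
      unfolding Phi_def X_def \<eta>_def k_def \<epsilon>_def .
  qed
qed

section \<open>Compact support and the admissible test exponent\<close>

lemma C1c_gradI:
  assumes "C1_grad f Df" "\<And>x. x \<notin> ball 0 r \<Longrightarrow> f x = 0"
  shows "C1c_grad f Df"
proof -
  have "{x. f x \<noteq> 0} \<subseteq> ball 0 r" using assms(2) by blast
  then have "bounded {x. f x \<noteq> 0}" using bounded_ball bounded_subset by blast
  then show ?thesis using assms(1) by (simp add: C1c_grad_def)
qed

text \<open>
  Paying the zero-order term in u powr (-\<delta>) instead of u powr (-\<gamma>) shrinks s_p by the factor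
  (p-1+\<delta>)/(p-1+\<gamma>) < 1, which gives strict inequality below.
\<close>
lemma test_exponent:
  assumes p: "p \<ge> 2" and \<delta>: "0 < \<delta>" "\<delta> < \<gamma>" and Pb: "class_Pb \<delta> p"
  obtains \<alpha> where "\<alpha> > 0" "(p - 1) * \<alpha>\<^sup>2 < \<delta> * (2 * \<alpha> + 1)"
    "(S_pb \<delta> \<gamma> p - 1) * (\<delta> + p - 1) = 2 * \<alpha> + 2 - p" "S_pb \<delta> \<gamma> p > 1"
proof -
  define s where "s = s_p \<delta> p"
  have s: "s > 0"
  proof (cases "p = 2")
    case True
    then show ?thesis using \<delta> by (simp add: s_def s_p_def add_pos_nonneg)
  next
    case False
    \<comment> \<open>For p > 2, positivity of \<open>s_p\<close> is precisely the lower bound on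
      \<open>\<delta>\<close> in \<open>class_Pb\<close>.\<close>
    then have "(p - 1)\<^sup>2 / 4 < \<delta>" "p > 2" using Pb p by (auto simp: class_Pb_def)
    then show ?thesis by (simp add: s_def s_p_def field_simps power2_eq_square)
  qed
  \<comment> \<open>Chosen so that
    \<open>(S_pb \<delta> \<gamma> p - 1) * (\<delta> + p - 1) = 2 * t\<close>; the exponent
    relation then forces \<open>\<alpha>\<close>.\<close>
  define t where "t = s * (\<delta> + p - 1) / (p - 1 + \<gamma>)"
  have t: "t > 0" using s p \<delta> by (simp add: t_def)
  have ts: "t < s" using s p \<delta> by (simp add: t_def field_simps)
  define \<alpha> where "\<alpha> = t + (p - 2) / 2"
  have \<alpha>: "\<alpha> > 0" using t p by (simp add: \<alpha>_def add_pos_nonneg)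
  have sub: "(p - 1) * \<alpha>\<^sup>2 < \<delta> * (2 * \<alpha> + 1)"
  proof (cases "p = 2")
    case True
    \<comment> \<open>Completing the square, the claim reads (\<alpha> - \<delta>)^2 < \<delta>^2 +
      \<delta>, and the larger root of the corresponding equation in \<open>\<alpha>\<close> is
      \<open>s_p\<close>.\<close>
    then have "\<alpha> - \<delta> < sqrt (\<delta>\<^sup>2 + \<delta>)" "\<delta> - \<alpha> < sqrt (\<delta>\<^sup>2 + \<delta>)"
      using ts \<alpha> \<delta> real_less_rsqrt[of \<delta> "\<delta>\<^sup>2 + \<delta>"] by (auto simp: s_def s_p_def \<alpha>_def)
    then have "(\<alpha> - \<delta>)\<^sup>2 < (sqrt (\<delta>\<^sup>2 + \<delta>))\<^sup>2"
      by (intro power2_strict_mono) auto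
    then show ?thesis using True \<delta> by (simp add: power2_eq_square algebra_simps)
  next
    case False
    \<comment> \<open>In fact \<open>\<alpha>\<close> is below 2\<delta>/(p - 1) - 1/2; the weaker
      bound suffices because of the extra \<open>\<delta>\<close> on the right of the claim.\<close>
    then have "\<alpha> < 2 * \<delta> / (p - 1)" using ts p by (simp add: s_def s_p_def \<alpha>_def field_simps)
    then have "(p - 1) * \<alpha> * \<alpha> < 2 * \<delta> * \<alpha>" using p \<alpha> by (intro mult_strict_right_mono) (auto simp: field_simps)
    then show ?thesis using \<delta> by (simp add: power2_eq_square algebra_simps)
  qed
  show ?thesis
    by (rule that[of \<alpha>, OF \<alpha> sub])
      (use s p \<delta> in \<open>auto simp: S_pb_def s_def[symmetric] \<alpha>_def t_def field_simps\<close>)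
qed

section \<open>Integration over growing balls and the contradiction\<close>

theorem theorem3p3:
  fixes w g :: "real^'n \<Rightarrow> real" and p \<delta> \<gamma> lam C :: real
  assumes "p \<ge> 2"
    and "L1_loc w" and "L1_loc g"
    and "AE x in lebesgue. w x > 0" and "AE x in lebesgue. g x > 0"
    and "\<exists>M. AE x in lebesgue. \<bar>1 / g x\<bar> \<le> M"
    and "0 < \<delta>" and "\<delta> < \<gamma>" and "\<gamma> \<ge> 1"
    and "class_Pb \<delta> p"
    and "lam > 0" and "C > 0" and "lam < p * S_pb \<delta> \<gamma> p"
    and "\<forall>R\<ge>1. (\<integral>\<^sup>+x\<in>ball 0 (2 * R). ennreal (w x powr S_pb \<delta> \<gamma> p) \<partial>lebesgue)
                 \<le> ennreal (C * R powr lam)"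
  shows "\<not> (\<exists>u Du. C1_grad u Du \<and> (\<forall>x. u x \<ge> 1)
              \<and> weak_solution p \<delta> \<gamma> w g u Du \<and> stable p \<delta> \<gamma> w g u Du)"
proof
  assume "\<exists>u Du. C1_grad u Du \<and> (\<forall>x. u x \<ge> 1)
              \<and> weak_solution p \<delta> \<gamma> w g u Du \<and> stable p \<delta> \<gamma> w g u Du"
  then obtain u Du where u: "C1_grad u Du" and u1: "\<And>x. u x \<ge> 1"
    and weak: "weak_solution p \<delta> \<gamma> w g u Du" and stab: "stable p \<delta> \<gamma> w g u Du"
    by blast
  have upos: "u x > 0" for x using u1[of x] by simp
  note p = \<open>p \<ge> 2\<close> and \<delta> = \<open>0 < \<delta>\<close> \<open>\<delta> < \<gamma>\<close>
  define S where "S = S_pb \<delta> \<gamma> p"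
  obtain \<alpha> where \<alpha>: "\<alpha> > 0" "(p - 1) * \<alpha>\<^sup>2 < \<delta> * (2 * \<alpha> + 1)"
      "(S - 1) * (\<delta> + p - 1) = 2 * \<alpha> + 2 - p" and S: "S > 1"
    using test_exponent[OF p \<delta> \<open>class_Pb \<delta> p\<close>] unfolding S_def by blast
  \<comment> \<open>Above the left end the coefficient of the |Du|^p term is negative; below
    \<open>\<delta>\<close> the zero-order coefficients are.\<close>
  obtain \<mu> where \<mu>: "(p - 1) * \<alpha>\<^sup>2 / (2 * \<alpha> + 1) < \<mu>" "\<mu> < \<delta>"
    using dense[of "(p - 1) * \<alpha>\<^sup>2 / (2 * \<alpha> + 1)" \<delta>] \<alpha> by (auto simp: field_simps)
  have "(p - 1) * \<alpha>\<^sup>2 / (2 * \<alpha> + 1) \<ge> 0" using p \<alpha> by simp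
  with \<mu> have \<mu>0: "0 < \<mu>" by linarith
  have \<mu>1: "(p - 1) * \<alpha>\<^sup>2 < \<mu> * (2 * \<alpha> + 1)" using \<mu>(1) \<alpha>(1) by (simp add: field_simps)
  obtain M0 where M0: "AE x in lebesgue. \<bar>1 / g x\<bar> \<le> M0" using assms(6) by blast
  define M where "M = max M0 1"
  have M: "M > 0" by (simp add: M_def)
  have gM: "AE x in lebesgue. g x \<ge> 1 / M"
    using M0 \<open>AE x in lebesgue. g x > 0\<close>
  proof eventually_elim
    case (elim x)
    then have "1 / g x \<le> M" by (simp add: M_def)
    then show ?case using elim M by (simp add: field_simps)
  qed
  define k where "k = p * S / 2"
  define q where "q = - \<delta> - 2 * \<alpha> - 1"
  define \<epsilon> where "\<epsilon> = (\<delta> - \<mu>) / (2 * M)"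
  have \<epsilon>: "\<epsilon> > 0" using \<mu> M by (simp add: \<epsilon>_def)
  have "2 * 1 < p * S" using p S by (intro mult_le_less_imp_less) auto
  then have k: "k > 1" by (simp add: k_def)
  \<comment> \<open>\<open>B\<close> is fixed before any radius is chosen, so one constant serves
    all balls.\<close>
  obtain B where "B \<ge> 0" and B: "\<And>W G U \<psi> d \<xi> \<zeta>. \<lbrakk>W > 0; G \<ge> 1 / M; U > 0; \<psi> > 0; d > 0;
        norm \<zeta> \<le> k * \<psi> powr (k - 1) * d\<rbrakk> \<Longrightarrow>
      energy_density p \<delta> \<gamma> \<mu> W G U (\<xi>::real^'n)
        (U powr (- \<alpha>) * \<psi> powr k)
        (\<psi> powr k *\<^sub>R (- \<alpha> * U powr (- \<alpha> - 1)) *\<^sub>R \<xi> + U powr (- \<alpha>) *\<^sub>R \<zeta>)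
        (U powr (- 2 * \<alpha> - 1) * (\<psi> powr k * \<psi> powr k))
        ((\<psi> powr k * \<psi> powr k) *\<^sub>R ((- 2 * \<alpha> - 1) * U powr (- 2 * \<alpha> - 1 - 1)) *\<^sub>R \<xi>
          + U powr (- 2 * \<alpha> - 1) *\<^sub>R (\<psi> powr k *\<^sub>R \<zeta> + \<psi> powr k *\<^sub>R \<zeta>))
      \<le> B * (W powr S * d powr (p * S)) - \<epsilon> * (U powr q * \<psi> powr (p * S))"
    using pointwise_estimate[OF p \<delta> M \<mu>1 \<mu>0 \<mu>(2) S \<alpha>(3), where ?'n = 'n]
    unfolding k_def q_def \<epsilon>_def by blast
  \<comment> \<open>On the closed unit ball u lies between 1 and \<open>b\<close>; as
    \<open>q < 0\<close>, this bounds \<open>u x powr q\<close> below by \<open>b powr q\<close>,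
    which makes \<open>c\<close> below positive and independent of the radius.\<close>
  have "bounded (u ` cball 0 1)"
    using C1_gradD(2)[OF u] by (intro compact_imp_bounded compact_continuous_image)
      (auto intro: continuous_on_subset)
  then obtain b where "\<forall>x\<in>cball 0 1. \<bar>u x\<bar> \<le> b"
    unfolding bounded_iff by auto
  then have b: "u x \<le> b" if "x \<in> cball 0 1" for x using that by force
  have b1: "b \<ge> 1" using b[of 0] u1[of 0] by simp
  define c where "c = \<epsilon> * (b powr q * (3 / 4) powr (p * S))"
  have c: "c > 0" using \<epsilon> b1 by (simp add: c_def)
  let ?V = "measure lebesgue (cball (0::real^'n) 1)"
  \<comment> \<open>The gradient bound 1/R of the cutoff contributes R powr (-pS), the growth
    hypothesis contributes \<open>R powr lam\<close>.\<close>
  have bound: "c * ?V \<le> B * C * R powr (lam - p * S)" if R: "R \<ge> 1" for R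
  proof -
    let ?\<psi> = "\<lambda>x::real^'n. cutoff R x"
    let ?D = "\<lambda>x::real^'n. (- (k * ?\<psi> x powr (k - 1) / (2 * R\<^sup>2))) *\<^sub>R x"
    let ?\<phi> = "\<lambda>x. u x powr (- \<alpha>) * ?\<psi> x powr k"
    let ?v = "\<lambda>x. u x powr (- 2 * \<alpha> - 1) * (?\<psi> x powr k * ?\<psi> x powr k)"
    let ?D\<phi> = "\<lambda>x. ?\<psi> x powr k *\<^sub>R (- \<alpha> * u x powr (- \<alpha> - 1)) *\<^sub>R Du x + u x powr (- \<alpha>) *\<^sub>R ?D x"
    let ?Dv = "\<lambda>x. (?\<psi> x powr k * ?\<psi> x powr k) *\<^sub>R ((- 2 * \<alpha> - 1) * u x powr (- 2 * \<alpha> - 1 - 1)) *\<^sub>R Du x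
          + u x powr (- 2 * \<alpha> - 1) *\<^sub>R (?\<psi> x powr k *\<^sub>R ?D x + ?\<psi> x powr k *\<^sub>R ?D x)"
    note \<eta> = C1_grad_cutoff_powr[OF k, of R]
    have \<psi>0: "?\<psi> x = 0" if "x \<notin> ball 0 (2 * R)" for x
      using cutoff_pos_iff[of R x] cutoff_nonneg[of R x] that R by force
    have \<phi>: "C1c_grad ?\<phi> ?D\<phi>"
      by (rule C1c_gradI[OF C1_grad_mult[OF C1_grad_powr[OF u upos] \<eta>], of "2 * R"]) (simp add: \<psi>0)
    have v: "C1c_grad ?v ?Dv"
      by (rule C1c_gradI[OF C1_grad_mult[OF C1_grad_powr[OF u upos] C1_grad_mult[OF \<eta> \<eta>]], of "2 * R"])
        (simp add: \<psi>0)
    let ?E = "\<lambda>x. energy_density p \<delta> \<gamma> \<mu> (w x) (g x) (u x) (Du x) (?\<phi> x) (?D\<phi> x) (?v x) (?Dv x)"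
    note E = energy_density_integral_nonneg[OF p \<open>L1_loc w\<close> \<open>L1_loc g\<close> u upos weak stab \<phi> v, of \<mu>]
    let ?H = "\<lambda>x::real^'n. w x powr S * indicator (ball 0 (2 * R)) x"
    have Hm: "?H \<in> borel_measurable lebesgue"
    proof -
      have [measurable]: "w \<in> borel_measurable lebesgue" using \<open>L1_loc w\<close> by (simp add: L1_loc_def)
      have [measurable]: "ball (0::real^'n) (2 * R) \<in> sets lebesgue" by simp
      show ?thesis by measurable
    qed
    have Hn: "(\<integral>\<^sup>+x. ennreal (?H x) \<partial>lebesgue) \<le> ennreal (C * R powr lam)"
    proof -
      have "(\<integral>\<^sup>+x. ennreal (?H x) \<partial>lebesgue)
          = (\<integral>\<^sup>+x\<in>ball 0 (2 * R). ennreal (w x powr S_pb \<delta> \<gamma> p) \<partial>lebesgue)"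
        by (intro nn_integral_cong) (simp add: S_def indicator_def)
      then show ?thesis using assms(14) R by simp
    qed
    \<comment> \<open>Finiteness of the extended integral supplies the integrability that
      monotonicity of the real integral requires.\<close>
    have Hi: "integrable lebesgue ?H"
      using Hm Hn by (intro integrableI_nonneg) (auto intro: le_less_trans)
    have HC: "(\<integral>x. ?H x \<partial>lebesgue) \<le> C * R powr lam"
      using Hn \<open>C > 0\<close> by (intro integral_real_bounded) auto
    let ?F = "\<lambda>x. B * (1 / R) powr (p * S) * ?H x - c * indicator (cball 0 1) x"
    have I1: "integrable lebesgue (\<lambda>x. c * indicator (cball (0::real^'n) 1) x)"
      by (intro integrable_mult_right) (simp add: lmeasurable_iff_integrable[symmetric])
    have I2: "integrable lebesgue (\<lambda>x. B * (1 / R) powr (p * S) * ?H x)"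
      using Hi by (intro integrable_mult_right)
    have le: "AE x in lebesgue. ?E x \<le> ?F x"
      using gM \<open>AE x in lebesgue. w x > 0\<close>
    proof eventually_elim
      case (elim x)
      show ?case
      proof (cases "x \<in> ball 0 (2 * R)")
        \<comment> \<open>Both sides are 0 here: the cutoff vanishes, \<open>0 powr k\<close> is 0,
          and the unit ball lies inside the ball of radius 2R.\<close>
        case False
        then have "x \<notin> cball 0 1" using R by auto
        then show ?thesis using False \<psi>0[OF False] by (simp add: energy_density_def)
      next
        case True
        then have \<psi>: "?\<psi> x > 0" using cutoff_pos_iff[of R x] R by simp
        have "?E x \<le> B * (w x powr S * (1 / R) powr (p * S)) - \<epsilon> * (u x powr q * ?\<psi> x powr (p * S))"
          using elim upos[of x] \<psi> R k by (intro B norm_cutoff_powr_grad_le) auto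
        moreover have "c * indicator (cball 0 1) x \<le> \<epsilon> * (u x powr q * ?\<psi> x powr (p * S))"
        proof (cases "x \<in> cball 0 1")
          case True
          have "b powr q \<le> u x powr q"
            using b[OF True] upos[of x] \<alpha> \<delta> by (intro powr_mono2') (auto simp: q_def)
          moreover have "(3 / 4) powr (p * S) \<le> ?\<psi> x powr (p * S)"
            using cutoff_ge[OF R] True p S by (intro powr_mono2) auto
          ultimately show ?thesis
            using True \<epsilon> unfolding c_def by (auto intro!: mult_left_mono mult_mono)
        qed (use \<epsilon> in auto)
        ultimately show ?thesis using True by (simp add: mult_ac)
      qed
    qed
    have "0 \<le> (\<integral>x. ?E x \<partial>lebesgue)" by (rule E(2))
    also have "\<dots> \<le> (\<integral>x. ?F x \<partial>lebesgue)"
      by (rule integral_mono_AE[OF E(1) Bochner_Integration.integrable_diff[OF I2 I1] le])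
    also have "\<dots> = B * (1 / R) powr (p * S) * (\<integral>x. ?H x \<partial>lebesgue) - c * ?V"
      by (simp add: Bochner_Integration.integral_diff[OF I2 I1])
    also have "\<dots> \<le> B * (1 / R) powr (p * S) * (C * R powr lam) - c * ?V"
      using HC \<open>B \<ge> 0\<close> by (intro diff_right_mono mult_left_mono) auto
    also have "\<dots> = B * C * R powr (lam - p * S) - c * ?V"
      using R by (simp add: powr_divide powr_diff)
    finally show ?thesis by simp
  qed
  \<comment> \<open>The exponent is negative because \<open>lam < p * S\<close>.\<close>
  have lim: "((\<lambda>R. B * C * R powr (lam - p * S)) \<longlongrightarrow> 0) at_top"
    using assms(13) by (intro tendsto_mult_right_zero tendsto_neg_powr filterlim_ident) (simp add: S_def)
  \<comment> \<open>The left side of \<open>bound\<close> is independent of R, hence at most the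
    limit of the right side.\<close>
  have "c * ?V \<le> 0"
    by (rule tendsto_lowerbound[OF lim eventually_mono[OF eventually_ge_at_top bound]]) simp_all
  moreover have "?V > 0" using content_cball_pos[of 1 "0::real^'n"] by simp
  ultimately show False using mult_pos_pos[OF c, of ?V] by linarith
qed

end
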